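(* Let $F$ be a finite connected bipartite graph with at least one edge. \begin{enumerate} \item Let $s$ be the size of the smaller part of $F$ (the common part size if the parts are equal). For all positive integers $a\le b$ such that the part sizes $p\le q$ of $F$ satisfy $p\le a$ and $q\le b$, we have $\mathrm{ex}_b(a,b,F)\ge (s-1)\big((a-s+1)+(b-s+1)\big)$. In particular, $\mathrm{ex}_b(n,F)\ge 2(s-1)(n-s+1)$ for every $n$ such that both part sizes of $F$ are at most $n$. \item Let $L$ be the size of the larger part of $F$ (the common part size if the parts are equal), and let $n\ge L$ be an integer. If $L\ge 2$, then $\mathrm{ex}_b(n,F)\ge\left\lfloor\frac{n}{L-1}\right\rfloor (L-1)^2$. Similarly, $$\mathrm{ex}_b(n,F)\ge\left\lfloor\frac{2n}{|V(F)|-1}\right\rfloor\cdot\left\lfloor\frac{|V(F)|-1}{2}\right\rfloor\left\lceil\frac{|V(F)|-1}{2}\right\rceil .$$ \end{enumerate}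
   Context: All graphs are finite and simple. A graph is $F$-free if it has no (not necessarily induced) subgraph isomorphic to $F$. $\mathrm{ex}_b(a,b,F)$ is the largest number of edges of an $F$-free bipartite graph with parts of sizes $a$ and $b$, and $\mathrm{ex}_b(n,F)=\mathrm{ex}_b(n,n,F)$. The parts of a connected bipartite graph are the two classes of its unique bipartition. *)

theory Defs
  imports Complex_Main
begin

record 'a graph =
  verts :: "'a set"
  edges :: "'a set set"

definition simple_graph :: "'a graph \<Rightarrow> bool" where
  "simple_graph G \<longleftrightarrow> finite (verts G) \<and>
     (\<forall>e\<in>edges G. \<exists>u\<in>verts G. \<exists>v\<in>verts G. u \<noteq> v \<and> e = {u, v})"

definition connected_graph :: "'a graph \<Rightarrow> bool" where
  "connected_graph G \<longleftrightarrow> verts G \<noteq> {} \<and>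
     (\<forall>u\<in>verts G. \<forall>v\<in>verts G. (u, v) \<in> {(x, y). {x, y} \<in> edges G}\<^sup>*)"

definition bipartition :: "'a graph \<Rightarrow> 'a set \<Rightarrow> 'a set \<Rightarrow> bool" where
  "bipartition G A B \<longleftrightarrow> A \<union> B = verts G \<and> A \<inter> B = {} \<and>
     (\<forall>e\<in>edges G. \<exists>u\<in>A. \<exists>v\<in>B. e = {u, v})"

definition subgraph :: "'a graph \<Rightarrow> 'a graph \<Rightarrow> bool" where
  "subgraph H G \<longleftrightarrow> simple_graph H \<and> verts H \<subseteq> verts G \<and> edges H \<subseteq> edges G"

definition graph_isomorphic :: "'a graph \<Rightarrow> 'b graph \<Rightarrow> bool" where
  "graph_isomorphic G H \<longleftrightarrow>
     (\<exists>f. bij_betw f (verts G) (verts H) \<and> edges H = (\<lambda>e. f ` e) ` edges G)"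

definition graph_free :: "'a graph \<Rightarrow> 'b graph \<Rightarrow> bool" where
  "graph_free F G \<longleftrightarrow> \<not> (\<exists>H. subgraph H G \<and> graph_isomorphic F H)"

text \<open>
  The host graphs have natural numbers as vertices; every finite graph is isomorphic to such
  a graph. The forbidden graph may live on any vertex type and may be embedded with either of its
  classes on either side of the host.
\<close>

definition ex_b_sizes :: "nat \<Rightarrow> nat \<Rightarrow> 'a graph \<Rightarrow> nat set" where
  "ex_b_sizes a b F =
     {card (edges G) | (G :: nat graph) X Y.
        simple_graph G \<and> bipartition G X Y \<and> card X = a \<and> card Y = b \<and> graph_free F G}"

definition ex_b :: "nat \<Rightarrow> nat \<Rightarrow> 'a graph \<Rightarrow> nat" where
  "ex_b a b F = Max (ex_b_sizes a b F)"

text \<open>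
  The maximum is taken over a finite set, and this set is nonempty as soon as the forbidden
  graph has an edge.
\<close>

lemma finite_ex_b_sizes: "finite (ex_b_sizes a b F)"
proof (rule finite_subset)
  show "ex_b_sizes a b F \<subseteq> {.. 2 ^ (a + b)}"
  proof
    fix m assume "m \<in> ex_b_sizes a b F"
    then obtain G :: "nat graph" and X Y where
      G: "m = card (edges G)" "simple_graph G" "bipartition G X Y" "card X = a" "card Y = b"
      unfolding ex_b_sizes_def by blast
    have fin: "finite (verts G)" and sub: "edges G \<subseteq> Pow (verts G)"
      using G(2) unfolding simple_graph_def by auto
    have V: "X \<union> Y = verts G" using G(3) by (simp add: bipartition_def)
    have "card (edges G) \<le> card (Pow (verts G))"
      using fin sub by (intro card_mono) auto
    also have "\<dots> = 2 ^ card (verts G)" using fin by (simp add: card_Pow)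
    also have "\<dots> \<le> 2 ^ (a + b)"
      using card_Un_le[of X Y] V G(4,5) by (intro power_increasing) auto
    finally show "m \<in> {.. 2 ^ (a + b)}" using G(1) by simp
  qed
qed simp

lemma ex_b_sizes_nonempty:
  assumes "edges F \<noteq> {}"
  shows "ex_b_sizes a b F \<noteq> {}"
proof -
  let ?G = "\<lparr>verts = {..<a + b}, edges = {}\<rparr> :: nat graph"
  have "simple_graph ?G" by (simp add: simple_graph_def)
  moreover have "bipartition ?G {..<a} {a..<a + b}" by (auto simp: bipartition_def)
  moreover have "graph_free F ?G"
    using assms by (auto simp: graph_free_def subgraph_def graph_isomorphic_def)
  ultimately have "card (edges ?G) \<in> ex_b_sizes a b F"
    unfolding ex_b_sizes_def by (intro CollectI exI[of _ ?G] exI[of _ "{..<a}"] exI[of _ "{a..<a + b}"]) simp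
  then show ?thesis by blast
qed

end

theory Submission
  imports Defs "HOL-Library.Disjoint_Sets"
begin

text \<open>
  All four bounds come from hosts that are disjoint unions of complete bipartite graphs, padded
  with isolated vertices. A copy of the connected graph \<open>F\<close> lies in a single component \<open>K\<close>, with each
  class of \<open>F\<close> inside one class of \<open>K\<close>, so it suffices that no component has room for both classes.
  The components are \<open>K(s-1, b-s+1)\<close> and \<open>K(a-s+1, s-1)\<close> for the first part; copies of
  \<open>K(L-1, L-1)\<close> for the second; and for the last, with \<open>m = |V(F)| - 1\<close>, copies of
  \<open>K(\<lfloor>m/2\<rfloor>, \<lceil>m/2\<rceil>)\<close> with alternating orientation, which keeps the two sides of the host balanced.
\<close>

text \<open>Induction along a walk from \<open>u\<close>. An edge maps across a single pair
  \<open>P j\<close>, \<open>Q j\<close>; as all these sets are disjoint, the position of one end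
  fixes both the index and the side of the other. The roles of \<open>P\<close> and \<open>Q\<close>
  are interchangeable, so a start in some \<open>Q i\<close> is covered by swapping the
  families.\<close>

lemma connected_bipartite_image:
  assumes "connected_graph F" "bipartition F A B"
    and edge: "\<And>u v. {u, v} \<in> edges F \<Longrightarrow>
      \<exists>i\<in>I. f u \<in> P i \<and> f v \<in> Q i \<or> f v \<in> P i \<and> f u \<in> Q i"
    and P: "disjoint_family_on P I" and Q: "disjoint_family_on Q I"
    and PQ: "\<And>i j. i \<in> I \<Longrightarrow> j \<in> I \<Longrightarrow> P i \<inter> Q j = {}"
    and u: "u \<in> A" and i: "i \<in> I" "f u \<in> P i"
  shows "f ` A \<subseteq> P i \<and> f ` B \<subseteq> Q i"
proof -
  have V: "A \<union> B = verts F" and AB: "A \<inter> B = {}"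
    and E: "\<And>e. e \<in> edges F \<Longrightarrow> \<exists>u\<in>A. \<exists>v\<in>B. e = {u, v}"
    using assms(2) unfolding bipartition_def by auto
  have "(w \<in> A \<longrightarrow> f w \<in> P i) \<and> (w \<in> B \<longrightarrow> f w \<in> Q i)" if "w \<in> verts F" for w
  proof -
    have "(u, w) \<in> {(x, y). {x, y} \<in> edges F}\<^sup>*"
      using assms(1) u V that unfolding connected_graph_def by blast
    then show ?thesis
    proof (induction rule: rtrancl_induct)
      case base
      show ?case using u i AB by blast
    next
      case (step y z)
      then have yz: "{y, z} \<in> edges F" by simp
      obtain j where j: "j \<in> I" "f y \<in> P j \<and> f z \<in> Q j \<or> f z \<in> P j \<and> f y \<in> Q j"
        using edge[OF yz] by blast
      \<comment> \<open>The image of \<open>y\<close> lies in a class with index \<open>i\<close> by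
        induction and in one with index \<open>j\<close> by the edge condition. \<open>PQij\<close>
        rules out opposite sides, and on the same side disjointness forces
        \<open>j = i\<close>.\<close>
      have Pj: "j = i" if "x \<in> P i" "x \<in> P j" for x
        using P that i(1) j(1) unfolding disjoint_family_on_def by blast
      have Qj: "j = i" if "x \<in> Q i" "x \<in> Q j" for x
        using Q that i(1) j(1) unfolding disjoint_family_on_def by blast
      have PQij: "P i \<inter> Q j = {}" "P j \<inter> Q i = {}" using PQ i(1) j(1) by auto
      consider "y \<in> A" "z \<in> B" | "z \<in> A" "y \<in> B"
        using E[OF yz] by (auto simp: doubleton_eq_iff)
      then show ?case
      proof cases
        case 1
        then have "f y \<in> P i" using step.IH by blast
        then have "f z \<in> Q i" using j(2) PQij Pj by blast
        then show ?thesis using 1 AB by blast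
      next
        case 2
        then have "f y \<in> Q i" using step.IH by blast
        then have "f z \<in> P i" using j(2) PQij Qj by blast
        then show ?thesis using 2 AB by blast
      qed
    qed
  qed
  then show ?thesis using V by blast
qed

text \<open>The host is a disjoint union of graphs K(\<open>x i\<close>, \<open>y i\<close>);
  vertices left over on either side stay isolated, so the sums need only be bounded.
  \<open>no_fit\<close> excludes both orientations because a copy of \<open>F\<close> may place
  either class on either side of the host.\<close>

lemma ex_b_ge_complete_bipartite_union:
  fixes F :: "'a graph" and x y :: "nat \<Rightarrow> nat"
  assumes "simple_graph F" "connected_graph F" "bipartition F A B" "edges F \<noteq> {}"
    and sx: "sum x {..<k} \<le> a" and sy: "sum y {..<k} \<le> b"
    and no_fit: "\<And>i. i < k \<Longrightarrow> \<not> (card A \<le> x i \<and> card B \<le> y i) \<and> \<not> (card B \<le> x i \<and> card A \<le> y i)"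
  shows "(\<Sum>i<k. x i * y i) \<le> ex_b a b F"
proof -
  \<comment> \<open>Partial sums as end points pack the classes into consecutive intervals, the left
    ones starting at 0 and the right ones at \<open>a\<close>.\<close>
  define P where "P i = {sum x {..<i} ..< sum x {..<Suc i}}" for i
  define Q where "Q i = {a + sum y {..<i} ..< a + sum y {..<Suc i}}" for i
  define E where "E = (\<lambda>(u, v). {u, v}) ` (\<Union>i<k. P i \<times> Q i)"
  define G :: "nat graph" where "G = \<lparr>verts = {..<a + b}, edges = E\<rparr>"
  have mono: "sum z {..<i} \<le> sum z {..<j}" if "i \<le> j" for z :: "nat \<Rightarrow> nat" and i j
    using that by (intro sum_mono2) auto
  \<comment> \<open>Here and below, \<open>sum.lessThan_Suc\<close> is switched off so that the
    partial sums up to \<open>Suc i\<close> keep the form in which \<open>mono\<close> compares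
    them.\<close>
  have PX: "P i \<subseteq> {..<a}" if "i < k" for i
    using mono[of "Suc i" k x] that sx by (auto simp: P_def simp del: sum.lessThan_Suc)
  have QY: "Q i \<subseteq> {a..<a + b}" if "i < k" for i
    using mono[of "Suc i" k y] that sy by (auto simp: Q_def simp del: sum.lessThan_Suc)
  have disjP: "disjoint_family_on P {..<k}"
    unfolding disjoint_family_on_def
  proof safe
    fix i j v assume "i \<noteq> j" "v \<in> P i" "v \<in> P j"
    then show "v \<in> {}"
      using mono[of "Suc i" j x] mono[of "Suc j" i x]
      by (cases i j rule: linorder_cases) (auto simp: P_def simp del: sum.lessThan_Suc)
  qed
  have disjQ: "disjoint_family_on Q {..<k}"
    unfolding disjoint_family_on_def
  proof safe
    fix i j v assume "i \<noteq> j" "v \<in> Q i" "v \<in> Q j"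
    then show "v \<in> {}"
      using mono[of "Suc i" j y] mono[of "Suc j" i y]
      by (cases i j rule: linorder_cases) (auto simp: Q_def simp del: sum.lessThan_Suc)
  qed
  have PQ: "P i \<inter> Q j = {}" if "i < k" "j < k" for i j
    using PX[OF that(1)] QY[OF that(2)] by fastforce
  then have QP: "Q i \<inter> P j = {}" if "i < k" "j < k" for i j
    using that by blast
  have cP: "card (P i) = x i" and cQ: "card (Q i) = y i" for i
    by (simp_all add: P_def Q_def)
  have finPQ: "finite (P i)" "finite (Q i)" for i by (simp_all add: P_def Q_def)
  have EXY: "\<exists>u\<in>{..<a}. \<exists>v\<in>{a..<a + b}. e = {u, v}" if "e \<in> E" for e
  proof -
    obtain i u v where "i < k" "u \<in> P i" "v \<in> Q i" "e = {u, v}"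
      using \<open>e \<in> E\<close> unfolding E_def by auto
    then show ?thesis using PX[of i] QY[of i] by blast
  qed
  have simple: "simple_graph G"
    unfolding simple_graph_def
  proof (intro conjI ballI)
    fix e assume "e \<in> edges G"
    then obtain u v where "u < a" "a \<le> v" "v < a + b" "e = {u, v}"
      using EXY[of e] by (auto simp: G_def)
    then show "\<exists>u\<in>verts G. \<exists>v\<in>verts G. u \<noteq> v \<and> e = {u, v}"
      by (intro bexI[of _ u] bexI[of _ v]) (auto simp: G_def)
  qed (simp add: G_def)
  have bip: "bipartition G {..<a} {a..<a + b}"
    unfolding bipartition_def using EXY by (auto simp: G_def)
  \<comment> \<open>Left ends lie below \<open>a\<close> and right ends do not, so an unordered edge
    determines its ordered pair and edges can be counted as pairs.\<close>
  have "inj_on (\<lambda>(u, v). {u, v}) (\<Union>i<k. P i \<times> Q i)"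
  proof (rule inj_on_subset)
    show "inj_on (\<lambda>(u, v). {u, v}) ({..<a} \<times> {a..<a + b})"
      by (auto simp: inj_on_def doubleton_eq_iff)
    show "(\<Union>i<k. P i \<times> Q i) \<subseteq> {..<a} \<times> {a..<a + b}" using PX QY by blast
  qed
  then have "card E = card (\<Union>i<k. P i \<times> Q i)"
    unfolding E_def by (rule card_image)
  also have "\<dots> = (\<Sum>i<k. card (P i \<times> Q i))"
  proof (rule card_UN_disjoint)
    show "\<forall>i\<in>{..<k}. \<forall>j\<in>{..<k}. i \<noteq> j \<longrightarrow> (P i \<times> Q i) \<inter> (P j \<times> Q j) = {}"
      using disjP unfolding disjoint_family_on_def by blast
  qed (use finPQ in auto)
  finally have cE: "card (edges G) = (\<Sum>i<k. x i * y i)"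
    by (simp add: G_def cP cQ card_cartesian_product)
  have free: "graph_free F G"
    unfolding graph_free_def
  proof
    assume "\<exists>H. subgraph H G \<and> graph_isomorphic F H"
    then obtain H where sub: "subgraph H G" and iso: "graph_isomorphic F H" by blast
    obtain f where f: "bij_betw f (verts F) (verts H)" "edges H = (\<lambda>e. f ` e) ` edges F"
      using iso unfolding graph_isomorphic_def by blast
    have edge: "\<exists>i\<in>{..<k}. f u \<in> P i \<and> f v \<in> Q i \<or> f v \<in> P i \<and> f u \<in> Q i"
      if "{u, v} \<in> edges F" for u v
    proof -
      have "f ` {u, v} \<in> edges H" using f(2) that by blast
      then have "f ` {u, v} \<in> E" using sub by (auto simp: subgraph_def G_def)
      then have "{f u, f v} \<in> E" by simp
      then obtain i c d where "i < k" "c \<in> P i" "d \<in> Q i" "{f u, f v} = {c, d}"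
        unfolding E_def by auto
      then show ?thesis by (intro bexI[of _ i]) (auto simp: doubleton_eq_iff)
    qed
    then have edge': "\<exists>i\<in>{..<k}. f u \<in> Q i \<and> f v \<in> P i \<or> f v \<in> Q i \<and> f u \<in> P i"
      if "{u, v} \<in> edges F" for u v
      using that by blast
    \<comment> \<open>An end of an edge is a safe starting vertex: its image lies in a component and
      is not one of the isolated vertices of the host.\<close>
    obtain e where e: "e \<in> edges F" using assms(4) by blast
    then obtain u v where "u \<in> A" "v \<in> B" "e = {u, v}"
      using assms(3) unfolding bipartition_def by meson
    with e have uv: "u \<in> A" "{u, v} \<in> edges F" by auto
    obtain i where i: "i \<in> {..<k}" "f u \<in> P i \<or> f u \<in> Q i"
      using edge[OF uv(2)] by blast
    have AB: "A \<subseteq> verts F" "B \<subseteq> verts F" using assms(3) by (auto simp: bipartition_def)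
    have inj: "inj_on f A" "inj_on f B"
      using f(1) AB by (auto simp: bij_betw_def intro: inj_on_subset)
    from i(2) show False
    proof
      assume "f u \<in> P i"
      then have "f ` A \<subseteq> P i \<and> f ` B \<subseteq> Q i"
        by (intro connected_bipartite_image[OF assms(2,3) edge disjP disjQ PQ uv(1) i(1)]) auto
      then have "card A \<le> x i" "card B \<le> y i"
        using inj finPQ card_inj_on_le[of f A "P i"] card_inj_on_le[of f B "Q i"]
        by (auto simp: cP cQ)
      then show False using no_fit i(1) by auto
    next
      assume "f u \<in> Q i"
      then have "f ` A \<subseteq> Q i \<and> f ` B \<subseteq> P i"
        by (intro connected_bipartite_image[OF assms(2,3) edge' disjQ disjP QP uv(1) i(1)]) auto
      then have "card A \<le> y i" "card B \<le> x i"
        using inj finPQ card_inj_on_le[of f A "Q i"] card_inj_on_le[of f B "P i"]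
        by (auto simp: cP cQ)
      then show False using no_fit i(1) by auto
    qed
  qed
  have "card (edges G) \<in> ex_b_sizes a b F"
    unfolding ex_b_sizes_def using simple bip free
    by (intro CollectI exI[of _ G] exI[of _ "{..<a}"] exI[of _ "{a..<a + b}"]) auto
  then show ?thesis
    unfolding ex_b_def using cE Max_ge[OF finite_ex_b_sizes] by metis
qed

text \<open>Two consecutive terms add up to \<open>m\<close>. For odd \<open>k\<close> the unpaired
  last term has even index and is the floor of m/2, which after doubling falls short of
  \<open>m\<close> by one exactly when \<open>m\<close> is odd.\<close>

lemma sum_alternating_halves:
  fixes m k :: nat
  shows "2 * (\<Sum>i<k. if even i then m div 2 else m - m div 2) + of_bool (odd k \<and> odd m) = k * m"
proof (induction k)
  case (Suc k)
  have "2 * (m div 2) + of_bool (odd m) = m" by (cases "even m") auto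
  moreover from this have "2 * (m - m div 2) = m + of_bool (odd m)" by linarith
  ultimately show ?case using Suc by (cases "even k"; cases "even m"; simp; linarith)
qed simp

theorem proposition4:
  fixes F :: "'a graph" and A B :: "'a set" and s L :: nat
  assumes "simple_graph F"
    and "connected_graph F"
    and "bipartition F A B"
    and "edges F \<noteq> {}"
    and "s = min (card A) (card B)"
    and "L = max (card A) (card B)"
  shows
    "(\<forall>a b :: nat. 1 \<le> a \<and> a \<le> b \<and> s \<le> a \<and> L \<le> b \<longrightarrow>
        int (ex_b a b F) \<ge> (int s - 1) * ((int a - int s + 1) + (int b - int s + 1))) \<and>
     (\<forall>n :: nat. card A \<le> n \<and> card B \<le> n \<longrightarrow>
        int (ex_b n n F) \<ge> 2 * (int s - 1) * (int n - int s + 1)) \<and>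
     (\<forall>n :: nat. L \<le> n \<and> 2 \<le> L \<longrightarrow>
        int (ex_b n n F) \<ge> \<lfloor>real n / (real L - 1)\<rfloor> * (int L - 1)\<^sup>2) \<and>
     (\<forall>n :: nat. L \<le> n \<longrightarrow>
        int (ex_b n n F) \<ge>
          \<lfloor>2 * real n / (real (card (verts F)) - 1)\<rfloor> *
          \<lfloor>(real (card (verts F)) - 1) / 2\<rfloor> * \<lceil>(real (card (verts F)) - 1) / 2\<rceil>)"
proof -
  note bound = ex_b_ge_complete_bipartite_union[OF assms(1-4)]
  have V: "A \<union> B = verts F" "A \<inter> B = {}" using assms(3) by (auto simp: bipartition_def)
  have "finite (verts F)" using assms(1) by (simp add: simple_graph_def)
  then have fin: "finite A" "finite B" by (auto simp flip: V(1))
  have "A \<noteq> {}" "B \<noteq> {}" using assms(3,4) unfolding bipartition_def by blast+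
  then have pos: "1 \<le> card A" "1 \<le> card B" using fin by (auto simp: Suc_le_eq card_gt_0_iff)
  then have s1: "1 \<le> s" using assms(5) by simp
  have cV: "card (verts F) = card A + card B"
    using card_Un_disjoint[OF fin V(2)] V(1) by simp
  have part1: "int (ex_b a b F) \<ge> (int s - 1) * ((int a - int s + 1) + (int b - int s + 1))"
    if "s \<le> a" "s \<le> b" for a b
  proof -
    \<comment> \<open>The two components fill both sides exactly. Each has a class of size
      \<open>s - 1\<close>, too small for either class of \<open>F\<close>.\<close>
    define x where "x i = (if i = 0 then s - 1 else a + 1 - s)" for i :: nat
    define y where "y i = (if i = 0 then b + 1 - s else s - 1)" for i :: nat
    have "(\<Sum>i<2. x i * y i) \<le> ex_b a b F"
    proof (rule bound)
      show "sum x {..<2} \<le> a" "sum y {..<2} \<le> b"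
        using that s1 by (simp_all add: x_def y_def numeral_2_eq_2)
      show "\<not> (card A \<le> x i \<and> card B \<le> y i) \<and> \<not> (card B \<le> x i \<and> card A \<le> y i)" for i
        using s1 assms(5) by (auto simp: x_def y_def)
    qed
    then have "(s - 1) * (b + 1 - s) + (a + 1 - s) * (s - 1) \<le> ex_b a b F"
      by (simp add: x_def y_def numeral_2_eq_2)
    then have "int ((s - 1) * (b + 1 - s) + (a + 1 - s) * (s - 1)) \<le> int (ex_b a b F)"
      by (simp only: of_nat_le_iff)
    moreover have "int (s - 1) = int s - 1" "int (a + 1 - s) = int a + 1 - int s"
      "int (b + 1 - s) = int b + 1 - int s"
      using that s1 by auto
    ultimately show ?thesis
      by (simp only: of_nat_add of_nat_mult) (simp add: algebra_simps)
  qed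
  have part2: "int (ex_b n n F) \<ge> \<lfloor>real n / (real L - 1)\<rfloor> * (int L - 1)\<^sup>2" if "2 \<le> L" for n
  proof -
    \<comment> \<open>This is how many blocks of size \<open>L - 1\<close> fit into \<open>n\<close>
      vertices. No block has room for the larger class of \<open>F\<close>.\<close>
    define k where "k = n div (L - 1)"
    have "(\<Sum>i<k. (L - 1) * (L - 1)) \<le> ex_b n n F"
      by (rule bound) (use that assms(6) in \<open>auto simp: k_def\<close>)
    then have "int (k * ((L - 1) * (L - 1))) \<le> int (ex_b n n F)"
      by (simp only: of_nat_le_iff) simp
    moreover have "\<lfloor>real n / (real L - 1)\<rfloor> = int k"
      using floor_divide_of_nat_eq[of n "L - 1", where 'a = real] that
      by (simp add: k_def of_nat_diff)
    ultimately show ?thesis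
      using that by (simp add: of_nat_diff power2_eq_square)
  qed
  have part3: "int (ex_b n n F) \<ge>
      \<lfloor>2 * real n / (real (card (verts F)) - 1)\<rfloor> *
      \<lfloor>(real (card (verts F)) - 1) / 2\<rfloor> * \<lceil>(real (card (verts F)) - 1) / 2\<rceil>" for n
  proof -
    \<comment> \<open>Each component will have \<open>m\<close> vertices, one fewer than
      \<open>F\<close>, which excludes a copy in either orientation.\<close>
    define m where "m = card (verts F) - 1"
    have m: "card A + card B = m + 1" and rm: "real (card (verts F)) - 1 = real m"
      using pos by (auto simp: m_def cV)
    define k where "k = (2 * n) div m"
    \<comment> \<open>\<open>m - m div 2\<close> is the ceiling of m/2; the parity of
      \<open>i\<close> decides which side receives it.\<close>
    define x where "x i = (if even i then m div 2 else m - m div 2)" for i :: nat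
    define y where "y i = (if even i then m - m div 2 else m div 2)" for i :: nat
    have km: "k * m \<le> 2 * n" by (simp add: k_def)
    have xy: "x i + y i = m" "x i * y i = (m div 2) * (m - m div 2)" for i
      by (simp_all add: x_def y_def)
    have sum_x: "2 * sum x {..<k} + of_bool (odd k \<and> odd m) = k * m"
      unfolding x_def by (rule sum_alternating_halves)
    have "sum x {..<k} + sum y {..<k} = k * m"
      by (simp add: xy flip: sum.distrib)
    \<comment> \<open>The two sides are equal unless \<open>k\<close> and \<open>m\<close> are both
      odd, when the \<open>y\<close> side is larger by one. In that case \<open>k * m\<close> is
      odd, hence less than \<open>2 * n\<close>, and the larger side
      \<open>(k * m + 1) div 2\<close> is still at most \<open>n\<close>.\<close>
    then have le: "sum x {..<k} \<le> n" "sum y {..<k} \<le> n"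
      using sum_x km by (cases "odd k \<and> odd m"; simp; presburger)+
    have "(\<Sum>i<k. x i * y i) \<le> ex_b n n F"
    proof (rule bound[OF le])
      show "\<not> (card A \<le> x i \<and> card B \<le> y i) \<and> \<not> (card B \<le> x i \<and> card A \<le> y i)" for i
        using xy(1)[of i] m by linarith
    qed
    then have "int (k * ((m div 2) * (m - m div 2))) \<le> int (ex_b n n F)"
      by (simp only: of_nat_le_iff) (simp add: xy)
    moreover have "\<lfloor>2 * real n / real m\<rfloor> = int k"
      using floor_divide_of_nat_eq[of "2 * n" m, where 'a = real] by (simp add: k_def)
    moreover have "\<lfloor>real m / 2\<rfloor> = int (m div 2)"
      using floor_divide_of_nat_eq[of m 2, where 'a = real] by simp
    moreover have "\<lceil>real m / 2\<rceil> = int (m - m div 2)"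
    proof (cases "even m")
      case True
      then show ?thesis by (auto elim!: evenE)
    next
      case False
      then obtain j where "m = 2 * j + 1" by (auto elim!: oddE)
      then show ?thesis by (simp add: ceiling_eq_iff)
    qed
    ultimately show ?thesis by (simp add: rm mult.assoc)
  qed
  have part1': "int (ex_b n n F) \<ge> 2 * (int s - 1) * (int n - int s + 1)" if "s \<le> n" for n
    using part1[OF that that] by (simp add: algebra_simps)
  show ?thesis
  proof (intro conjI allI impI)
    fix n assume "card A \<le> n \<and> card B \<le> n"
    then show "int (ex_b n n F) \<ge> 2 * (int s - 1) * (int n - int s + 1)"
      using assms(5) by (intro part1') auto
  qed (use part1 part2 part3 in auto)
qed

end
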